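(* Let $\mathcal T=\{(s,t)\in\mathbb R^2: 0\le s\le t\}$ and let $\{E^{[s,t]}:(s,t)\in\mathcal T\}$ be a chain of three-dimensional real evolution algebras whose matrices of structural constants are $$\mathcal M^{[s,t]}=\begin{pmatrix} a_1^{[s,t]}&a_2^{[s,t]}&a_3^{[s,t]}\\ 0&a_4^{[s,t]}&a_5^{[s,t]}\\ 0&0&a_6^{[s,t]}\end{pmatrix},\qquad \det\mathcal M^{[s,t]}=a_1^{[s,t]}a_4^{[s,t]}a_6^{[s,t]}\neq 0\ \text{ for all }(s,t)\in\mathcal T.$$ Writing $a_i=a_i^{[s,t]}$, put $$D_1=1-\frac{4a_5a_6}{a_4^2},\quad D_2=1-\frac{4a_2a_4}{a_1^2},\quad D_3=1-4a_6\Big(\frac{a_3}{a_1^2}+\frac{a_5}{(2a_4)^2}\Big),$$ and, when $D_2\ge 0$, $$y_{4}=\frac{1+\sqrt{D_2}}{2a_4},\quad y_5=\frac{1-\sqrt{D_2}}{2a_4},\quad D_j=1-4a_6\Big(\frac{a_3}{a_1^2}+a_5y_j^2\Big)\ (j=4,5)$$ (all depending on $(s,t)$). Then for every $(s,t)\in\mathcal T$: 1. $E^{[s,t]}$ is baric. 2. $x=0$ is the unique absolute nilpotent element of $E^{[s,t]}$. 3. In coordinates with respect to the basis $e_1,e_2,e_3$, the set of idempotents $\mathcal{I}d(E^{[s,t]})$ is the union of $\{\lambda_1,\lambda_2\}$, where $\lambda_1=(0,0,0)$, $\lambda_2=(0,0,\tfrac1{a_6})$, with those of the following sets whose condition holds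 at $(s,t)$: - $\{\lambda_3\}$, $\lambda_3=\big(0,\tfrac1{a_4},\tfrac1{2a_6}\big)$, if $D_1=0$; - $\{\lambda_4,\lambda_5\}$, $\lambda_{4,5}=\big(0,\tfrac1{a_4},\tfrac{1\pm\sqrt{D_1}}{2a_6}\big)$, if $D_1>0$; - $\{\lambda_6\}$, $\lambda_6=\big(\tfrac1{a_1},\tfrac1{2a_4},\tfrac1{2a_6}\big)$, if $D_2=D_3=0$; - $\{\lambda_7,\lambda_8\}$, $\lambda_{7,8}=\big(\tfrac1{a_1},\tfrac1{2a_4},\tfrac{1\pm\sqrt{D_3}}{2a_6}\big)$, if $D_2=0$ and $D_3>0$; - $\{\lambda_9\}$, $\lambda_9=\big(\tfrac1{a_1},y_4,\tfrac1{2a_6}\big)$, if $D_2>0$ and $D_4=0$; - $\{\lambda_{10},\lambda_{11}\}$, $\lambda_{10,11}=\big(\tfrac1{a_1},y_4,\tfrac{1\pm\sqrt{D_4}}{2a_6}\big)$, if $D_2>0$ and $D_4>0$; - $\{\lambda_{12}\}$, $\lambda_{12}=\big(\tfrac1{a_1},y_5,\tfrac1{2a_6}\big)$, if $D_2>0$ and $D_5=0$; - $\{\lambda_{13},\lambda_{14}\}$, $\lambda_{13,14}=\big(\tfrac1{a_1},y_5,\tfrac{1\pm\sqrt{D_5}}{2a_6}\big)$, if $D_2>0$ and $D_5>0$.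
   Context: A family $\{E^{[s,t]}: 0\le s\le t\}$ of $n$-dimensional real evolution algebras consists of algebras with common basis $e_1,\dots,e_n$ and multiplication $e_ie_i=\sum_{j=1}^n a_{ij}^{[s,t]}e_j$, $e_ie_j=0$ for $i\ne j$ (extended bilinearly); $\mathcal M^{[s,t]}=(a_{ij}^{[s,t]})$ is its matrix of structural constants (row $i$ gives $e_ie_i$). It is a chain of evolution algebras if $\mathcal M^{[s,t]}=\mathcal M^{[s,\tau]}\mathcal M^{[\tau,t]}$ for all $0\le s<\tau<t$. A real algebra $A$ is baric if it admits a character, i.e. a nonzero algebra homomorphism $\sigma:A\to\mathbb R$. An element $x\in A$ is absolute nilpotent if $x^2=0$, and idempotent if $x^2=x$ (so $0$ is both); $\mathcal{I}d(A)$ denotes the set of idempotents of $A$. *)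

theory Defs
  imports "HOL-Analysis.Analysis"
begin

text \<open>
  A real algebra is a real vector space together with a bilinear multiplication \<open>m\<close>,
  not assumed associative, commutative or unital. Algebras with a common basis are different
  multiplications on one and the same vector space.
\<close>

definition is_basis :: "('n::finite \<Rightarrow> 'a::real_vector) \<Rightarrow> bool" where
  "is_basis e \<longleftrightarrow> inj e \<and> independent (range e) \<and> span (range e) = UNIV"

definition coords :: "('n::finite \<Rightarrow> 'a::real_vector) \<Rightarrow> 'a \<Rightarrow> real ^ 'n" where
  "coords e x = (\<chi> i. representation (range e) x (e i))"

definition evolution_algebra ::
  "('n::finite \<Rightarrow> 'a::real_vector) \<Rightarrow> real ^ 'n ^ 'n \<Rightarrow> ('a \<Rightarrow> 'a \<Rightarrow> 'a) \<Rightarrow> bool" where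
  "evolution_algebra e M m \<longleftrightarrow>
     is_basis e \<and> bilinear m \<and>
     (\<forall>i. m (e i) (e i) = (\<Sum>j\<in>UNIV. M $ i $ j *\<^sub>R e j)) \<and>
     (\<forall>i j. i \<noteq> j \<longrightarrow> m (e i) (e j) = 0)"

text \<open>
  Families are total functions of \<open>s\<close> and \<open>t\<close>; their values outside \<open>0 \<le> s \<le> t\<close> are irrelevant.
\<close>

definition chain_of_evolution_algebras ::
  "('n::finite \<Rightarrow> 'a::real_vector) \<Rightarrow> (real \<Rightarrow> real \<Rightarrow> real ^ 'n ^ 'n)
     \<Rightarrow> (real \<Rightarrow> real \<Rightarrow> 'a \<Rightarrow> 'a \<Rightarrow> 'a) \<Rightarrow> bool" where
  "chain_of_evolution_algebras e M E \<longleftrightarrow>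
     (\<forall>s t. 0 \<le> s \<and> s \<le> t \<longrightarrow> evolution_algebra e (M s t) (E s t)) \<and>
     (\<forall>s \<tau> t. 0 \<le> s \<and> s < \<tau> \<and> \<tau> < t \<longrightarrow> M s t = M s \<tau> ** M \<tau> t)"

definition character :: "('a::real_vector \<Rightarrow> 'a \<Rightarrow> 'a) \<Rightarrow> ('a \<Rightarrow> real) \<Rightarrow> bool" where
  "character m \<sigma> \<longleftrightarrow>
     linear \<sigma> \<and> (\<forall>x y. \<sigma> (m x y) = \<sigma> x * \<sigma> y) \<and> (\<exists>x. \<sigma> x \<noteq> 0)"

definition baric :: "('a::real_vector \<Rightarrow> 'a \<Rightarrow> 'a) \<Rightarrow> bool" where
  "baric m \<longleftrightarrow> (\<exists>\<sigma>. character m \<sigma>)"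

definition absolute_nilpotent :: "('a::real_vector \<Rightarrow> 'a \<Rightarrow> 'a) \<Rightarrow> 'a \<Rightarrow> bool" where
  "absolute_nilpotent m x \<longleftrightarrow> m x x = 0"

definition idempotents :: "('a::real_vector \<Rightarrow> 'a \<Rightarrow> 'a) \<Rightarrow> 'a set" where
  "idempotents m = {x. m x x = x}"

end

theory Submission
  imports Defs
begin

text \<open>
  In coordinates squaring is \<open>v \<mapsto> (v\<^sub>i\<^sup>2)\<^sub>i M\<close>, so a triangular \<open>M\<close> turns both \<open>x\<^sup>2 = 0\<close> and
  \<open>x\<^sup>2 = x\<close> into triangular systems of three quadratics in one variable each, which are solved
  in turn. The first column of \<open>M\<close> is \<open>(a\<^sub>1, 0, 0)\<close>, which makes \<open>x \<mapsto> a\<^sub>1 x\<^sub>1\<close> a character.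
\<close>

lemma linear_coords:
  assumes "is_basis e"
  shows "linear (coords e)"
  using assms
  by (intro linearI)
    (simp_all add: coords_def is_basis_def vec_eq_iff representation_add representation_scale)

lemma sum_coords:
  assumes "is_basis e"
  shows "(\<Sum>i\<in>UNIV. coords e x $ i *\<^sub>R e i) = x"
proof -
  have "(\<Sum>i\<in>UNIV. coords e x $ i *\<^sub>R e i) =
      (\<Sum>b\<in>range e. representation (range e) x b *\<^sub>R b)"
    using assms by (simp add: coords_def is_basis_def sum.reindex)
  also have "\<dots> = x"
    using assms by (intro real_vector.sum_representation_eq) (auto simp: is_basis_def)
  finally show ?thesis .
qed

lemma coords_basis:
  assumes "is_basis e"
  shows "coords e (e i) = axis i 1"
  using assms
  by (auto simp: coords_def is_basis_def vec_eq_iff axis_def representation_basis inj_eq)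

lemma coords_sum:
  fixes e :: "'n::finite \<Rightarrow> 'a::real_vector"
  assumes "is_basis e"
  shows "coords e (\<Sum>i\<in>UNIV. c i *\<^sub>R e i) = (\<chi> i. c i)"
  using assms
  by (simp add: linear_sum[OF linear_coords] linear_cmul[OF linear_coords] coords_basis
      vec_eq_iff axis_def if_distrib cong: if_cong)

lemma coords_eq_iff:
  assumes "is_basis e"
  shows "coords e x = coords e y \<longleftrightarrow> x = y"
  by (metis sum_coords[OF assms])

lemma surj_coords:
  assumes "is_basis e"
  shows "surj (coords e)"
  by (rule surjI[where f = "\<lambda>v. \<Sum>i\<in>UNIV. v $ i *\<^sub>R e i"]) (simp add: coords_sum[OF assms])

text \<open>Expanding both factors in the basis gives a double sum over products of basis vectors.
  The mixed products vanish, and each surviving square \<open>m (e i) (e i)\<close> contributes row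
  \<open>i\<close> of \<open>M\<close>.\<close>

lemma coords_evolution_mult:
  fixes e :: "'n::finite \<Rightarrow> 'a::real_vector"
  assumes "evolution_algebra e M m"
  shows "coords e (m x y) = (\<chi> j. \<Sum>i\<in>UNIV. coords e x $ i * coords e y $ i * M $ i $ j)"
proof -
  have e: "is_basis e" and m: "bilinear m"
    and square: "\<And>i. m (e i) (e i) = (\<Sum>j\<in>UNIV. M $ i $ j *\<^sub>R e j)"
    and ortho: "\<And>i j. i \<noteq> j \<Longrightarrow> m (e i) (e j) = 0"
    using assms by (auto simp: evolution_algebra_def)
  let ?x = "coords e x" and ?y = "coords e y"
  have "m x y = m (\<Sum>i\<in>UNIV. ?x $ i *\<^sub>R e i) (\<Sum>j\<in>UNIV. ?y $ j *\<^sub>R e j)"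
    by (simp only: sum_coords[OF e])
  also have "\<dots> = (\<Sum>i\<in>UNIV. \<Sum>j\<in>UNIV. (?x $ i * ?y $ j) *\<^sub>R m (e i) (e j))"
    by (simp add: bilinear_sum[OF m] sum.cartesian_product bilinear_lmul[OF m]
        bilinear_rmul[OF m] mult.commute)
  also have "\<dots> = (\<Sum>i\<in>UNIV. \<Sum>j\<in>UNIV. if i = j then (?x $ i * ?y $ i) *\<^sub>R m (e i) (e i) else 0)"
    by (intro sum.cong) (auto simp: ortho)
  also have "\<dots> = (\<Sum>i\<in>UNIV. (?x $ i * ?y $ i) *\<^sub>R m (e i) (e i))"
    by simp
  finally show ?thesis
    by (simp add: square linear_sum[OF linear_coords[OF e]] linear_cmul[OF linear_coords[OF e]]
        coords_basis[OF e] vec_eq_iff axis_def if_distrib cong: if_cong)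
qed

text \<open>Injectivity of \<open>coords e\<close> turns idempotency into the polynomial system;
  surjectivity guarantees that every solution of the system in coordinate space comes from an
  element of the algebra.\<close>

lemma coords_image_idempotents:
  fixes e :: "'n::finite \<Rightarrow> 'a::real_vector"
  assumes "evolution_algebra e M m"
  shows "coords e ` idempotents m = {v. \<forall>j. (\<Sum>i\<in>UNIV. (v $ i)\<^sup>2 * M $ i $ j) = v $ j}"
proof -
  have e: "is_basis e"
    using assms by (simp add: evolution_algebra_def)
  have "x \<in> idempotents m \<longleftrightarrow>
      (\<forall>j. (\<Sum>i\<in>UNIV. (coords e x $ i)\<^sup>2 * M $ i $ j) = coords e x $ j)" for x
    by (simp add: idempotents_def coords_eq_iff[OF e, symmetric] coords_evolution_mult[OF assms]
        vec_eq_iff power2_eq_square)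
  then show ?thesis
    using surj_coords[OF e] by (auto simp: image_iff surj_def) metis
qed

text \<open>Multiplying by \<open>4 * a\<close> and completing the square leaves
  \<open>(2 * a * x - 1)\<^sup>2 = D\<close>. The double root is kept apart from the two roots for
  \<open>D > 0\<close> because the classification of idempotents lists these cases separately; for
  \<open>D < 0\<close> both disjuncts fail.\<close>

lemma quadratic_roots_iff:
  fixes a c x :: real
  assumes "a \<noteq> 0"
  defines "D \<equiv> 1 - 4 * a * c"
  shows "c + a * x\<^sup>2 = x \<longleftrightarrow> D = 0 \<and> x = 1 / (2 * a)
    \<or> D > 0 \<and> (x = (1 + sqrt D) / (2 * a) \<or> x = (1 - sqrt D) / (2 * a))"
proof -
  have "4 * a * (c + a * x\<^sup>2 - x) = (2 * a * x - 1)\<^sup>2 - D"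
    by (simp add: D_def power2_eq_square algebra_simps)
  then have square: "c + a * x\<^sup>2 = x \<longleftrightarrow> (2 * a * x - 1)\<^sup>2 = D"
    using assms(1) by (metis eq_iff_diff_eq_0 mult_eq_0_iff zero_neq_numeral)
  show ?thesis
  proof (cases "D \<ge> 0")
    case True
    then have "(2 * a * x - 1)\<^sup>2 = D \<longleftrightarrow> (2 * a * x - 1)\<^sup>2 = (sqrt D)\<^sup>2"
      by simp
    also have "\<dots> \<longleftrightarrow> x = (1 + sqrt D) / (2 * a) \<or> x = (1 - sqrt D) / (2 * a)"
      using assms(1) by (auto simp: power2_eq_iff field_simps)
    finally show ?thesis
      using True square by auto
  next
    case False
    then show ?thesis
      using square by (metis order_less_imp_le order_refl zero_le_power2)
  qed
qed

lemma eq_vector_3_iff: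
  fixes v :: "'a::zero ^ 3"
  shows "v = vector [x, y, z] \<longleftrightarrow> v $ 1 = x \<and> v $ 2 = y \<and> v $ 3 = z"
  by (simp add: vec_eq_iff forall_3)

lemma det_upper_triangular_3:
  fixes a1 a2 a3 a4 a5 a6 :: "'a::comm_ring_1"
  shows "det (vector [vector [a1, a2, a3], vector [0, a4, a5], vector [0, 0, a6]]
    :: 'a ^ 3 ^ 3) = a1 * a4 * a6"
  by (simp add: det_3)

theorem theorem4:
  fixes e :: "3 \<Rightarrow> 'a::real_vector"
    and M :: "real \<Rightarrow> real \<Rightarrow> real ^ 3 ^ 3"
    and E :: "real \<Rightarrow> real \<Rightarrow> 'a \<Rightarrow> 'a \<Rightarrow> 'a"
    and a1 a2 a3 a4 a5 a6 :: "real \<Rightarrow> real \<Rightarrow> real"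
  assumes chain: "chain_of_evolution_algebras e M E"
    and M: "\<And>s t. 0 \<le> s \<Longrightarrow> s \<le> t \<Longrightarrow>
      M s t = vector [vector [a1 s t, a2 s t, a3 s t],
                      vector [0,      a4 s t, a5 s t],
                      vector [0,      0,      a6 s t]]"
    and det: "\<And>s t. 0 \<le> s \<Longrightarrow> s \<le> t \<Longrightarrow> det (M s t) \<noteq> 0"
  shows "\<forall>s t. 0 \<le> s \<and> s \<le> t \<longrightarrow>
    (let A1 = a1 s t; A2 = a2 s t; A3 = a3 s t;
         A4 = a4 s t; A5 = a5 s t; A6 = a6 s t;
         D1 = 1 - 4 * A5 * A6 / A4 ^ 2;
         D2 = 1 - 4 * A2 * A4 / A1 ^ 2;
         D3 = 1 - 4 * A6 * (A3 / A1 ^ 2 + A5 / (2 * A4) ^ 2);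
         y4 = (1 + sqrt D2) / (2 * A4);
         y5 = (1 - sqrt D2) / (2 * A4);
         D4 = 1 - 4 * A6 * (A3 / A1 ^ 2 + A5 * y4 ^ 2);
         D5 = 1 - 4 * A6 * (A3 / A1 ^ 2 + A5 * y5 ^ 2)
     in baric (E s t)
      \<and> (\<forall>x. absolute_nilpotent (E s t) x \<longleftrightarrow> x = 0)
      \<and> coords e ` idempotents (E s t) =
             {vector [0, 0, 0], vector [0, 0, 1 / A6]}
           \<union> (if D1 = 0 then {vector [0, 1 / A4, 1 / (2 * A6)]} else {})
           \<union> (if D1 > 0 then {vector [0, 1 / A4, (1 + sqrt D1) / (2 * A6)],
                       vector [0, 1 / A4, (1 - sqrt D1) / (2 * A6)]} else {})
           \<union> (if D2 = 0 \<and> D3 = 0 then {vector [1 / A1, 1 / (2 * A4), 1 / (2 * A6)]} else {})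
           \<union> (if D2 = 0 \<and> D3 > 0 then {vector [1 / A1, 1 / (2 * A4), (1 + sqrt D3) / (2 * A6)],
                       vector [1 / A1, 1 / (2 * A4), (1 - sqrt D3) / (2 * A6)]} else {})
           \<union> (if D2 > 0 \<and> D4 = 0 then {vector [1 / A1, y4, 1 / (2 * A6)]} else {})
           \<union> (if D2 > 0 \<and> D4 > 0 then {vector [1 / A1, y4, (1 + sqrt D4) / (2 * A6)],
                       vector [1 / A1, y4, (1 - sqrt D4) / (2 * A6)]} else {})
           \<union> (if D2 > 0 \<and> D5 = 0 then {vector [1 / A1, y5, 1 / (2 * A6)]} else {})
           \<union> (if D2 > 0 \<and> D5 > 0 then {vector [1 / A1, y5, (1 + sqrt D5) / (2 * A6)],
                       vector [1 / A1, y5, (1 - sqrt D5) / (2 * A6)]} else {}))"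
proof (intro allI impI)
  fix s t :: real
  assume st: "0 \<le> s \<and> s \<le> t"
  let ?A1 = "a1 s t" and ?A2 = "a2 s t" and ?A3 = "a3 s t"
    and ?A4 = "a4 s t" and ?A5 = "a5 s t" and ?A6 = "a6 s t"
  have alg: "evolution_algebra e (M s t) (E s t)"
    using chain st by (simp add: chain_of_evolution_algebras_def)
  then have e: "is_basis e"
    by (simp add: evolution_algebra_def)
  have Mst: "M s t = vector [vector [?A1, ?A2, ?A3], vector [0, ?A4, ?A5], vector [0, 0, ?A6]]"
    using M st by blast
  have nz: "?A1 \<noteq> 0" "?A4 \<noteq> 0" "?A6 \<noteq> 0"
    using det[of s t] st by (simp_all add: Mst det_upper_triangular_3)
  note mult = coords_evolution_mult[OF alg]

  have "character (E s t) (\<lambda>x. ?A1 * coords e x $ 1)"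
    unfolding character_def
  proof (intro conjI allI)
    show "linear (\<lambda>x. ?A1 * coords e x $ 1)"
      by (intro linearI)
        (simp_all add: linear_add[OF linear_coords[OF e]] linear_cmul[OF linear_coords[OF e]]
          algebra_simps)
    show "?A1 * coords e (E s t x y) $ 1 = ?A1 * coords e x $ 1 * (?A1 * coords e y $ 1)" for x y
      by (simp add: mult sum_3 Mst)
    show "\<exists>x. ?A1 * coords e x $ 1 \<noteq> 0"
      using nz by (intro exI[of _ "e 1"]) (simp add: coords_basis[OF e])
  qed
  then have baric: "baric (E s t)"
    by (auto simp: baric_def)

  have "E s t x x = 0 \<longleftrightarrow> x = 0" for x
  proof -
    have "E s t x x = 0 \<longleftrightarrow> coords e (E s t x x) = 0"
      using coords_eq_iff[OF e, of "E s t x x" 0] by (simp add: linear_0[OF linear_coords[OF e]])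
    \<comment> \<open>The first coordinate of the square is \<open>?A1\<close> times a square, so
      the first coordinate of \<open>x\<close> vanishes; then the second and third follow in the
      same way from \<open>?A4\<close> and \<open>?A6\<close>.\<close>
    also have "\<dots> \<longleftrightarrow> coords e x = 0"
      using nz by (auto simp: mult vec_eq_iff forall_3 sum_3 Mst)
    also have "\<dots> \<longleftrightarrow> x = 0"
      using coords_eq_iff[OF e, of x 0] by (simp add: linear_0[OF linear_coords[OF e]])
    finally show ?thesis .
  qed
  then have nilpotent: "\<forall>x. absolute_nilpotent (E s t) x \<longleftrightarrow> x = 0"
    by (simp add: absolute_nilpotent_def)

  define D1 where "D1 = 1 - 4 * ?A5 * ?A6 / ?A4 ^ 2"
  define D2 where "D2 = 1 - 4 * ?A2 * ?A4 / ?A1 ^ 2"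
  \<comment> \<open>Discriminant of the third equation when the first coordinate is
    \<open>1 / ?A1\<close> and the second is \<open>y\<close>. The numbers D3, D4, D5 of the
    statement are its values at \<open>1 / (2 * ?A4)\<close>, \<open>y4\<close> and
    \<open>y5\<close>.\<close>
  define D where "D y = 1 - 4 * ?A6 * (?A3 / ?A1 ^ 2 + ?A5 * y ^ 2)" for y
  \<comment> \<open>As \<open>sqrt\<close> is total, these terms exist even for
    \<open>D2 < 0\<close>, where they are not roots; every use below is guarded by
    \<open>D2 > 0\<close>.\<close>
  define y4 where "y4 = (1 + sqrt D2) / (2 * ?A4)"
  define y5 where "y5 = (1 - sqrt D2) / (2 * ?A4)"
  have D3: "1 - 4 * ?A6 * (?A3 / ?A1 ^ 2 + ?A5 / (2 * ?A4) ^ 2) = D (1 / (2 * ?A4))"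
    by (simp add: D_def power_divide)

  have zero_roots: "a * x ^ 2 = x \<longleftrightarrow> x = 0 \<or> x = 1 / a" if "a \<noteq> 0" for a x :: real
    using that by (auto simp: power2_eq_square field_simps)
  \<comment> \<open>The terms are grouped so that each equation after the first has the shape
    \<open>c + a * x\<^sup>2 = x\<close>, with \<open>c\<close> depending only on the earlier
    unknowns.\<close>
  have sys: "(\<forall>j. (\<Sum>i\<in>UNIV. (v $ i)\<^sup>2 * M s t $ i $ j) = v $ j) \<longleftrightarrow>
      ?A1 * (v $ 1) ^ 2 = v $ 1 \<and>
      ?A2 * (v $ 1) ^ 2 + ?A4 * (v $ 2) ^ 2 = v $ 2 \<and>
      (?A3 * (v $ 1) ^ 2 + ?A5 * (v $ 2) ^ 2) + ?A6 * (v $ 3) ^ 2 = v $ 3" for v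
    by (simp add: forall_3 sum_3 Mst mult.commute)

  \<comment> \<open>Third equation for first coordinate 0 and second coordinate
    \<open>1 / ?A4\<close>.\<close>
  have branch1: "?A5 * (1 / ?A4) ^ 2 + ?A6 * z ^ 2 = z \<longleftrightarrow> D1 = 0 \<and> z = 1 / (2 * ?A6)
      \<or> D1 > 0 \<and> (z = (1 + sqrt D1) / (2 * ?A6) \<or> z = (1 - sqrt D1) / (2 * ?A6))" for z
  proof -
    have "D1 = 1 - 4 * ?A6 * (?A5 * (1 / ?A4) ^ 2)"
      by (simp add: D1_def power_divide)
    then show ?thesis
      using quadratic_roots_iff[OF nz(3)] by metis
  qed
  have branch2: "?A2 * (1 / ?A1) ^ 2 + ?A4 * y ^ 2 = y \<longleftrightarrow> D2 = 0 \<and> y = 1 / (2 * ?A4)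
      \<or> D2 > 0 \<and> (y = y4 \<or> y = y5)" for y
  proof -
    have "D2 = 1 - 4 * ?A4 * (?A2 * (1 / ?A1) ^ 2)"
      by (simp add: D2_def power_divide)
    then show ?thesis
      using quadratic_roots_iff[OF nz(2)] unfolding y4_def y5_def by metis
  qed
  \<comment> \<open>Naming this condition lets it act as an atom while the choices for
    \<open>y\<close> are separated; it is opened only at the very end.\<close>
  define R where "R y z \<longleftrightarrow> D y = 0 \<and> z = 1 / (2 * ?A6)
      \<or> D y > 0 \<and> (z = (1 + sqrt (D y)) / (2 * ?A6) \<or> z = (1 - sqrt (D y)) / (2 * ?A6))" for y z
  have branch3: "(?A3 * (1 / ?A1) ^ 2 + ?A5 * y ^ 2) + ?A6 * z ^ 2 = z \<longleftrightarrow> R y z" for y z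
  proof -
    have "D y = 1 - 4 * ?A6 * (?A3 * (1 / ?A1) ^ 2 + ?A5 * y ^ 2)"
      by (simp add: D_def power_divide)
    then show ?thesis
      using quadratic_roots_iff[OF nz(3)] unfolding R_def by metis
  qed

  \<comment> \<open>For \<open>x = 0\<close> the second equation has no constant term, so
    \<open>y\<close> is 0 or \<open>1 / ?A4\<close>. For \<open>x = 1 / ?A1\<close> it is a full
    quadratic and stays unsolved here, ready for \<open>branch2\<close>.\<close>
  have sols: "?A1 * x ^ 2 = x \<and> ?A2 * x ^ 2 + ?A4 * y ^ 2 = y
        \<and> (?A3 * x ^ 2 + ?A5 * y ^ 2) + ?A6 * z ^ 2 = z \<longleftrightarrow>
      x = 0 \<and> (y = 0 \<and> (z = 0 \<or> z = 1 / ?A6)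
        \<or> y = 1 / ?A4 \<and> ?A5 * (1 / ?A4) ^ 2 + ?A6 * z ^ 2 = z)
      \<or> x = 1 / ?A1 \<and> ?A2 * (1 / ?A1) ^ 2 + ?A4 * y ^ 2 = y
        \<and> (?A3 * (1 / ?A1) ^ 2 + ?A5 * y ^ 2) + ?A6 * z ^ 2 = z"
    (is "?lhs \<longleftrightarrow> ?rhs") for x y z
  proof -
    have "?lhs \<longleftrightarrow> (x = 0 \<and> ?A4 * y ^ 2 = y \<and> ?A5 * y ^ 2 + ?A6 * z ^ 2 = z)
        \<or> x = 1 / ?A1 \<and> ?A2 * (1 / ?A1) ^ 2 + ?A4 * y ^ 2 = y
          \<and> (?A3 * (1 / ?A1) ^ 2 + ?A5 * y ^ 2) + ?A6 * z ^ 2 = z"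
      unfolding zero_roots[OF nz(1)] using nz(1) by auto
    also have "\<dots> \<longleftrightarrow> ?rhs"
      unfolding zero_roots[OF nz(2)] using zero_roots[OF nz(3), of z] by auto
    finally show ?thesis .
  qed

  \<comment> \<open>Substituting each root for \<open>y\<close> inside \<open>R\<close> produces
    exactly the discriminants D3, D4, D5.\<close>
  have branch23: "(D2 = 0 \<and> y = 1 / (2 * ?A4) \<or> D2 > 0 \<and> (y = y4 \<or> y = y5)) \<and> R y z \<longleftrightarrow>
      D2 = 0 \<and> y = 1 / (2 * ?A4) \<and> R (1 / (2 * ?A4)) z
      \<or> D2 > 0 \<and> y = y4 \<and> R y4 z \<or> D2 > 0 \<and> y = y5 \<and> R y5 z" for y z
    by blast

  have mem_if: "v \<in> (if P then S else {}) \<longleftrightarrow> P \<and> v \<in> S" for v :: "real ^ 3" and P S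
    by simp

  show "(let A1 = ?A1; A2 = ?A2; A3 = ?A3; A4 = ?A4; A5 = ?A5; A6 = ?A6;
         D1 = 1 - 4 * A5 * A6 / A4 ^ 2;
         D2 = 1 - 4 * A2 * A4 / A1 ^ 2;
         D3 = 1 - 4 * A6 * (A3 / A1 ^ 2 + A5 / (2 * A4) ^ 2);
         y4 = (1 + sqrt D2) / (2 * A4);
         y5 = (1 - sqrt D2) / (2 * A4);
         D4 = 1 - 4 * A6 * (A3 / A1 ^ 2 + A5 * y4 ^ 2);
         D5 = 1 - 4 * A6 * (A3 / A1 ^ 2 + A5 * y5 ^ 2)
     in baric (E s t)
      \<and> (\<forall>x. absolute_nilpotent (E s t) x \<longleftrightarrow> x = 0)
      \<and> coords e ` idempotents (E s t) =
             {vector [0, 0, 0], vector [0, 0, 1 / A6]}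
           \<union> (if D1 = 0 then {vector [0, 1 / A4, 1 / (2 * A6)]} else {})
           \<union> (if D1 > 0 then {vector [0, 1 / A4, (1 + sqrt D1) / (2 * A6)],
                       vector [0, 1 / A4, (1 - sqrt D1) / (2 * A6)]} else {})
           \<union> (if D2 = 0 \<and> D3 = 0 then {vector [1 / A1, 1 / (2 * A4), 1 / (2 * A6)]} else {})
           \<union> (if D2 = 0 \<and> D3 > 0 then {vector [1 / A1, 1 / (2 * A4), (1 + sqrt D3) / (2 * A6)],
                       vector [1 / A1, 1 / (2 * A4), (1 - sqrt D3) / (2 * A6)]} else {})
           \<union> (if D2 > 0 \<and> D4 = 0 then {vector [1 / A1, y4, 1 / (2 * A6)]} else {})
           \<union> (if D2 > 0 \<and> D4 > 0 then {vector [1 / A1, y4, (1 + sqrt D4) / (2 * A6)],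
                       vector [1 / A1, y4, (1 - sqrt D4) / (2 * A6)]} else {})
           \<union> (if D2 > 0 \<and> D5 = 0 then {vector [1 / A1, y5, 1 / (2 * A6)]} else {})
           \<union> (if D2 > 0 \<and> D5 > 0 then {vector [1 / A1, y5, (1 + sqrt D5) / (2 * A6)],
                       vector [1 / A1, y5, (1 - sqrt D5) / (2 * A6)]} else {}))"
    unfolding Let_def D3 D1_def[symmetric] D2_def[symmetric] y4_def[symmetric] y5_def[symmetric]
      D_def[symmetric]
  proof (intro conjI baric nilpotent set_eqI, goal_cases)
    case (1 v)
    show ?case
      unfolding coords_image_idempotents[OF alg] mem_Collect_eq sys sols branch1 branch2 branch3
        Un_iff mem_if insert_iff empty_iff eq_vector_3_iff branch23
      unfolding R_def
      \<comment> \<open>Both sides are now Boolean combinations of the same coordinate equations and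
        sign conditions; only propositional regrouping remains.\<close>
      by argo
  qed
qed

end
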